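(* Let $(E,\mathcal{E})$ be a Lusin space and let $L$ be a Markov operator on $\mathcal{L}^\infty(E)$. Let $(F,\mathcal{F})$ be a measurable space with a probability measure $\mu$, and let $\widetilde T$ be a dynamical system on $E\times F$ which dilates $L$. Write $\widetilde T(x,y)=(X(x,y),Y(x,y))$ with measurable maps $X:E\times F\to E$ and $Y:E\times F\to F$. Let $\widehat F=F^{\mathbb{N}^*}$, equipped with the cylinder $\sigma$-field $\mathcal{F}^{\otimes\mathbb{N}^*}$ and the product measure $\widehat\mu=\mu^{\otimes\mathbb{N}^*}$, and define $$\widetilde S:E\times\widehat F\to E\times\widehat F,\qquad \widetilde S(x,y)=\big(X(x,y_1),\Theta(y)\big),$$ where $y=(y_n)_{n\in\mathbb{N}^*}$ and $\Theta(y)=(y_{n+1})_{n\in\mathbb{N}^*}$ is the shift. Let $S$ be the operator on $\mathcal{L}^\infty(E\times\widehat F)$ given by $Sg=g\circ\widetilde S$. Then for all $n\in\mathbb{N}^*$, all $x\in E$ and all $f\in\mathcal{L}^\infty(E)$, $$\int_{\widehat F}S^n(f\otimes\mathbf{1})(x,y)\,d\widehat\mu(y)=(L^nf)(x).$$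
   Context: $\mathbb{N}^*=\{1,2,3,\dots\}$. $\mathcal{L}^\infty(E)$ is the space of bounded measurable functions on $E$. A Lusin space is a measurable space isomorphic, as a measurable space, to a Borel subset of a compact metrizable space. A Markov kernel on $(E,\mathcal{E})$ is a map $\nu:E\times\mathcal{E}\to[0,1]$ measurable in the first variable and a probability measure in the second; a Markov operator is an operator on $\mathcal{L}^\infty(E)$ of the form $Lf(x)=\int_E f(y)\,\nu(x,dy)$ for a Markov kernel $\nu$. A dynamical system on a measurable space is a measurable map from it to itself. The dynamical system $\widetilde T$ on $E\times F$ (with $F$ carrying the probability measure $\mu$) dilates $L$ if $Lf(x)=\int_F (f\otimes\mathbf{1})(\widetilde T(x,y))\,d\mu(y)$ for all $f\in\mathcal{L}^\infty(E)$ and $x\in E$. Here $f\otimes\mathbf{1}$ denotes the function $(x,y)\mapsto f(x)$, on $E\times F$ or on $E\times\widehat F$ according to context. *)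

theory Defs
  imports "HOL-Probability.Probability"
begin

text \<open>A measurable space is represented by a value of type \<open>'a measure\<close>, of which only
  \<open>space\<close> and \<open>sets\<close> are used.\<close>

definition measurable_isomorphic :: "'a measure \<Rightarrow> 'b measure \<Rightarrow> bool" where
  "measurable_isomorphic M N \<longleftrightarrow>
    (\<exists>f \<in> M \<rightarrow>\<^sub>M N. \<exists>g \<in> N \<rightarrow>\<^sub>M M.
      (\<forall>x\<in>space M. g (f x) = x) \<and> (\<forall>y\<in>space N. f (g y) = y))"

definition borel_of_topology :: "'k topology \<Rightarrow> 'k measure" where
  "borel_of_topology K = sigma (topspace K) {U. openin K U}"

text \<open>HOL cannot quantify existentially over the type of the points of the ambient compact
  metrizable space, so this type is a parameter. In a theorem with the hypothesis
  \<open>lusin_space TYPE('k) E\<close>, the type variable \<open>'k\<close> is universally quantified, which amounts to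
  an existential quantification over all ambient spaces within the hypothesis.\<close>

definition lusin_space :: "'k itself \<Rightarrow> 'a measure \<Rightarrow> bool" where
  "lusin_space _ E \<longleftrightarrow>
    (\<exists>(K :: 'k topology) B. compact_space K \<and> metrizable_space K \<and>
      B \<in> sets (borel_of_topology K) \<and>
      measurable_isomorphic E (restrict_space (borel_of_topology K) B))"

text \<open>The scalars range over the complete separable normed fields, i.e. both \<open>real\<close> and
  \<open>complex\<close> are covered. Functions are genuine functions, not classes modulo null sets;
  their values outside \<open>space E\<close> are irrelevant.\<close>

definition bounded_measurable ::
    "'a measure \<Rightarrow> ('a \<Rightarrow> 'c :: {real_normed_field, banach, second_countable_topology}) set" where
  "bounded_measurable E = {f \<in> borel_measurable E. bounded (f ` space E)}"

text \<open>\<open>E \<rightarrow>\<^sub>M prob_algebra E\<close> is the set of Markov kernels on \<open>E\<close>: the \<open>\<sigma>\<close>-algebra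
  of \<open>prob_algebra E\<close> is the one generated by the evaluations \<open>\<nu> \<mapsto> \<nu> A\<close> for \<open>A \<in> sets E\<close>.\<close>

definition markov_operator ::
    "'a measure \<Rightarrow> (('a \<Rightarrow> 'c :: {real_normed_field, banach, second_countable_topology}) \<Rightarrow> 'a \<Rightarrow> 'c) \<Rightarrow> bool" where
  "markov_operator E L \<longleftrightarrow>
    L \<in> bounded_measurable E \<rightarrow> bounded_measurable E \<and>
    (\<exists>\<nu> \<in> E \<rightarrow>\<^sub>M prob_algebra E. \<forall>f\<in>bounded_measurable E. \<forall>x\<in>space E.
      L f x = (\<integral>y. f y \<partial>\<nu> x))"

definition dynamical_system :: "'a measure \<Rightarrow> ('a \<Rightarrow> 'a) \<Rightarrow> bool" where
  "dynamical_system M T \<longleftrightarrow> T \<in> M \<rightarrow>\<^sub>M M"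

definition tensor_one :: "('a \<Rightarrow> 'c) \<Rightarrow> 'a \<times> 'b \<Rightarrow> 'c" where
  "tensor_one f = (\<lambda>(x, y). f x)"

definition dilates ::
    "'a measure \<Rightarrow> 'b measure \<Rightarrow> ('a \<times> 'b \<Rightarrow> 'a \<times> 'b) \<Rightarrow>
     (('a \<Rightarrow> 'c :: {real_normed_field, banach, second_countable_topology}) \<Rightarrow> 'a \<Rightarrow> 'c) \<Rightarrow> bool" where
  "dilates E \<mu> T L \<longleftrightarrow>
    (\<forall>f\<in>bounded_measurable E. \<forall>x\<in>space E. L f x = (\<integral>y. tensor_one f (T (x, y)) \<partial>\<mu>))"

text \<open>Sequences indexed by the positive integers are functions on \<open>nat\<close> that are \<open>undefined\<close>
  at \<open>0\<close>, as prescribed by \<open>Pi\<^sub>M {1..}\<close>.\<close>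

definition shift :: "(nat \<Rightarrow> 'b) \<Rightarrow> nat \<Rightarrow> 'b" where
  "shift y = (\<lambda>n\<in>{1..}. y (n + 1))"

definition product_system ::
    "('a \<times> 'b \<Rightarrow> 'a) \<Rightarrow> 'a \<times> (nat \<Rightarrow> 'b) \<Rightarrow> 'a \<times> (nat \<Rightarrow> 'b)" where
  "product_system X = (\<lambda>(x, y). (X (x, y 1), shift y))"

definition composition_operator :: "('d \<Rightarrow> 'd) \<Rightarrow> ('d \<Rightarrow> 'c) \<Rightarrow> 'd \<Rightarrow> 'c" where
  "composition_operator T g = g \<circ> T"

end

theory Submission
  imports Defs
begin

text \<open>A \<open>\<mu>\<^sup>\<infinity>\<close>-distributed sequence is a \<open>\<mu>\<close>-distributed first term followed by an independent
  \<open>\<mu>\<^sup>\<infinity>\<close>-distributed tail. Conditioning on the first term therefore gives \<open>n\<close> steps of the product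
  system started from \<open>X (x, y 1)\<close>, so by Fubini and induction the integral over \<open>n + 1\<close> steps is
  \<open>\<integral>y. (L ^^ n) f (X (x, y)) \<partial>\<mu>\<close>, which equals \<open>L ((L ^^ n) f) x\<close> by the dilation property.\<close>

lemma composition_operator_funpow:
  "(composition_operator T ^^ n) g = g \<circ> (T ^^ n)"
  by (induction n) (simp_all add: composition_operator_def funpow_swap1 fun_eq_iff)

text \<open>Peeling off the first step of the orbit, rather than the last, leaves a new starting
  point that uses only \<open>y 1\<close> and a sequence \<open>shift y\<close> independent of
  it.\<close>

lemma fst_product_system_funpow_Suc:
  "fst ((product_system X ^^ Suc n) (x, y)) =
    fst ((product_system X ^^ n) (X (x, y 1), shift y))"
  by (simp add: funpow_Suc_right product_system_def del: funpow.simps)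

lemma measurable_shift [measurable]:
  "shift \<in> Pi\<^sub>M {1..} (\<lambda>_. \<mu>) \<rightarrow>\<^sub>M Pi\<^sub>M {1..} (\<lambda>_. \<mu>)"
  unfolding shift_def by measurable

lemma measurable_product_system:
  assumes [measurable]: "X \<in> E \<Otimes>\<^sub>M \<mu> \<rightarrow>\<^sub>M E"
  shows "product_system X \<in> E \<Otimes>\<^sub>M Pi\<^sub>M {1..} (\<lambda>_. \<mu>) \<rightarrow>\<^sub>M E \<Otimes>\<^sub>M Pi\<^sub>M {1..} (\<lambda>_. \<mu>)"
  unfolding product_system_def by measurable

text \<open>The product over \<open>{1..}\<close> arises from \<mu> and the product over
  \<open>{2..}\<close> by inserting coordinate 1. Taking head and shift undoes this, up to moving
  the tail from \<open>{2..}\<close> to \<open>{1..}\<close>, and this reindexing carries one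
  product measure to the other.\<close>

lemma distr_PiM_head_shift:
  assumes "prob_space \<mu>"
  shows "distr (Pi\<^sub>M {1..} (\<lambda>_. \<mu>)) (\<mu> \<Otimes>\<^sub>M Pi\<^sub>M {1..} (\<lambda>_. \<mu>)) (\<lambda>y. (y 1, shift y)) =
    \<mu> \<Otimes>\<^sub>M Pi\<^sub>M {1..} (\<lambda>_. \<mu>)"
proof -
  let ?P = "Pi\<^sub>M {1::nat..} (\<lambda>_. \<mu>)" and ?Q = "Pi\<^sub>M {2::nat..} (\<lambda>_. \<mu>)"
  interpret P: prob_space ?P
    using assms by (intro prob_space_PiM)
  have [measurable]: "shift \<in> ?Q \<rightarrow>\<^sub>M ?P"
    unfolding shift_def by measurable
  have Q: "distr ?Q ?P shift = ?P"
    using distr_PiM_reindex[of "{2::nat..}" "\<lambda>_. \<mu>" "\<lambda>n. n + 1" "{1..}"] assms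
    by (simp add: shift_def[abs_def])
  have ins: "insert 1 {2::nat..} = {1..}"
    by auto
  have upd: "(\<lambda>(x, z). z(1 := x)) \<in> \<mu> \<Otimes>\<^sub>M ?Q \<rightarrow>\<^sub>M ?P"
    unfolding case_prod_beta by (rule measurable_fun_upd[where J = "{2..}"]) auto
  have "?P = distr (\<mu> \<Otimes>\<^sub>M ?Q) ?P (\<lambda>(x, z). z(1 := x))"
    using distr_pair_PiM_eq_PiM[of "{2::nat..}" "\<lambda>_. \<mu>" 1] assms unfolding ins by simp
  then have "distr ?P (\<mu> \<Otimes>\<^sub>M ?P) (\<lambda>y. (y 1, shift y)) =
      distr (distr (\<mu> \<Otimes>\<^sub>M ?Q) ?P (\<lambda>(x, z). z(1 := x))) (\<mu> \<Otimes>\<^sub>M ?P) (\<lambda>y. (y 1, shift y))"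
    by simp
  also have "\<dots> = distr (\<mu> \<Otimes>\<^sub>M ?Q) (\<mu> \<Otimes>\<^sub>M ?P) ((\<lambda>y. (y 1, shift y)) \<circ> (\<lambda>(x, z). z(1 := x)))"
    by (intro distr_distr upd) measurable
  \<comment> \<open>\<open>shift\<close> reads only indices from 2 on, so it does not see the
    inserted value.\<close>
  also have "(\<lambda>y. (y 1, shift y)) \<circ> (\<lambda>(x, z). z(1 := x)) = (\<lambda>(x, z). (x, shift z))"
    by (auto simp: fun_eq_iff shift_def)
  also have "distr (\<mu> \<Otimes>\<^sub>M ?Q) (\<mu> \<Otimes>\<^sub>M ?P) (\<lambda>(x, z). (x, shift z)) =
      distr \<mu> \<mu> (\<lambda>x. x) \<Otimes>\<^sub>M distr ?Q ?P shift"
    \<comment> \<open>The second image measure must be sigma-finite; \<open>Q\<close> identifies it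
      with the probability measure \<open>?P\<close>.\<close>
    by (intro pair_measure_distr[symmetric]) (simp_all only: Q P.sigma_finite_measure_axioms, measurable)
  finally show ?thesis
    by (simp only: Q distr_id)
qed

text \<open>The dilation formula is stated for bounded measurable functions, so applying it to
  \<open>(L ^^ n) f\<close> requires this closure.\<close>

lemma bounded_measurable_markov_funpow:
  assumes "markov_operator E L" and "f \<in> bounded_measurable E"
  shows "(L ^^ n) f \<in> bounded_measurable E"
  using assms by (induction n) (auto simp: markov_operator_def)

text \<open>Fubini on the product, transported along the measure-preserving head-and-shift map.
  Boundedness gives integrability, the total mass being 1.\<close>

lemma integral_PiM_head_shift:
  fixes g :: "'b \<times> (nat \<Rightarrow> 'b) \<Rightarrow> 'c::{banach, second_countable_topology}"
  assumes "prob_space \<mu>"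
    and g: "g \<in> borel_measurable (\<mu> \<Otimes>\<^sub>M Pi\<^sub>M {1..} (\<lambda>_. \<mu>))"
    and bdd: "bounded (g ` space (\<mu> \<Otimes>\<^sub>M Pi\<^sub>M {1..} (\<lambda>_. \<mu>)))"
  shows "(\<integral>y. g (y 1, shift y) \<partial>Pi\<^sub>M {1..} (\<lambda>_. \<mu>)) =
    (\<integral>u. (\<integral>z. g (u, z) \<partial>Pi\<^sub>M {1..} (\<lambda>_. \<mu>)) \<partial>\<mu>)"
proof -
  let ?P = "Pi\<^sub>M {1::nat..} (\<lambda>_. \<mu>)"
  interpret \<mu>: prob_space \<mu> by fact
  interpret N: prob_space ?P
    using assms by (intro prob_space_PiM)
  interpret pair_prob_space \<mu> ?P ..
  obtain B where "\<forall>w\<in>space (\<mu> \<Otimes>\<^sub>M ?P). norm (g w) \<le> B"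
    using bdd by (auto simp: bounded_iff)
  then have "integrable (\<mu> \<Otimes>\<^sub>M ?P) g"
    using g by (intro P.integrable_const_bound[of _ B]) auto
  then have "(\<integral>u. (\<integral>z. g (u, z) \<partial>?P) \<partial>\<mu>) = integral\<^sup>L (\<mu> \<Otimes>\<^sub>M ?P) g"
    by (rule integral_fst')
  also have "\<dots> = integral\<^sup>L (distr ?P (\<mu> \<Otimes>\<^sub>M ?P) (\<lambda>y. (y 1, shift y))) g"
    by (simp only: distr_PiM_head_shift[OF assms(1)])
  also have "\<dots> = (\<integral>y. g (y 1, shift y) \<partial>?P)"
    using g by (intro integral_distr) measurable
  finally show ?thesis ..
qed

theorem theorem2p5:
  fixes E :: "'a measure"
    and \<mu> :: "'b measure"
    and L :: "('a \<Rightarrow> 'c :: {real_normed_field, banach, second_countable_topology}) \<Rightarrow> 'a \<Rightarrow> 'c"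
    and T :: "'a \<times> 'b \<Rightarrow> 'a \<times> 'b"
    and X :: "'a \<times> 'b \<Rightarrow> 'a"
    and Y :: "'a \<times> 'b \<Rightarrow> 'b"
  assumes "lusin_space TYPE('k) E"
    and "markov_operator E L"
    and "prob_space \<mu>"
    and "dynamical_system (E \<Otimes>\<^sub>M \<mu>) T"
    and "dilates E \<mu> T L"
    and "X \<in> E \<Otimes>\<^sub>M \<mu> \<rightarrow>\<^sub>M E"
    and "Y \<in> E \<Otimes>\<^sub>M \<mu> \<rightarrow>\<^sub>M \<mu>"
    and "\<forall>x\<in>space E. \<forall>y\<in>space \<mu>. T (x, y) = (X (x, y), Y (x, y))"
  shows "\<forall>n\<ge>1. \<forall>x\<in>space E. \<forall>f\<in>bounded_measurable E.
    (\<integral>y. (composition_operator (product_system X) ^^ n) (tensor_one f) (x, y)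
        \<partial>Pi\<^sub>M {1..} (\<lambda>_. \<mu>)) = (L ^^ n) f x"
proof -
  let ?P = "Pi\<^sub>M {1::nat..} (\<lambda>_. \<mu>)" and ?S = "product_system X"
  interpret P: prob_space ?P
    using assms(3) by (intro prob_space_PiM)
  note X [measurable] = assms(6)
  have S [measurable]: "?S ^^ n \<in> E \<Otimes>\<^sub>M ?P \<rightarrow>\<^sub>M E \<Otimes>\<^sub>M ?P" for n
    by (intro measurable_compose_n measurable_product_system X)
  have L: "L g x = (\<integral>u. g (X (x, u)) \<partial>\<mu>)" if "g \<in> bounded_measurable E" "x \<in> space E" for g x
    using assms(5,8) that by (auto simp: dilates_def tensor_one_def intro!: Bochner_Integration.integral_cong)
  \<comment> \<open>The point \<open>x\<close> has to vary in the induction: the hypothesis is used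
    at every \<open>X (x, u)\<close>. The base \<open>n = 0\<close> integrates the constant
    \<open>f x\<close>.\<close>
  have *: "(\<integral>y. f (fst ((?S ^^ n) (x, y))) \<partial>?P) = (L ^^ n) f x"
    if f: "f \<in> bounded_measurable E" and x: "x \<in> space E" for f n x
    using x
  proof (induction n arbitrary: x)
    case 0
    then show ?case
      using P.prob_space by simp
  next
    case (Suc n)
    have [measurable]: "f \<in> borel_measurable E" and bdd: "bounded (f ` space E)"
      using f by (auto simp: bounded_measurable_def)
    have Xx: "X (x, u) \<in> space E" if "u \<in> space \<mu>" for u
      using measurable_space[OF X] that Suc.prems by (auto simp: space_pair_measure)
    \<comment> \<open>Head \<open>u\<close> and tail \<open>z\<close> become separate variables;
      substituting \<open>y 1\<close> and \<open>shift y\<close> recovers the integrand for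
      \<open>Suc n\<close>.\<close>
    let ?g = "\<lambda>(u, z). f (fst ((?S ^^ n) (X (x, u), z)))"
    have "?g \<in> borel_measurable (\<mu> \<Otimes>\<^sub>M ?P)"
      using Suc.prems by measurable
    moreover have "fst ((?S ^^ n) (X (x, u), z)) \<in> space E"
      if "u \<in> space \<mu>" "z \<in> space ?P" for u z
      using measurable_space[OF S, of "(X (x, u), z)" n] that Xx
      by (auto simp: space_pair_measure)
    then have "?g ` space (\<mu> \<Otimes>\<^sub>M ?P) \<subseteq> f ` space E"
      by (auto simp: space_pair_measure)
    then have "bounded (?g ` space (\<mu> \<Otimes>\<^sub>M ?P))"
      by (rule bounded_subset[OF bdd])
    ultimately have "(\<integral>y. ?g (y 1, shift y) \<partial>?P) = (\<integral>u. (\<integral>z. ?g (u, z) \<partial>?P) \<partial>\<mu>)"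
      by (rule integral_PiM_head_shift[OF assms(3)])
    then have "(\<integral>y. f (fst ((?S ^^ Suc n) (x, y))) \<partial>?P) =
        (\<integral>u. (\<integral>z. f (fst ((?S ^^ n) (X (x, u), z))) \<partial>?P) \<partial>\<mu>)"
      by (simp only: fst_product_system_funpow_Suc prod.case)
    also have "\<dots> = (\<integral>u. (L ^^ n) f (X (x, u)) \<partial>\<mu>)"
      by (intro Bochner_Integration.integral_cong refl Suc.IH Xx)
    \<comment> \<open>The remaining integral is one dilation step, applied to
      \<open>(L ^^ n) f\<close>.\<close>
    also have "\<dots> = (L ^^ Suc n) f x"
      using L[OF bounded_measurable_markov_funpow[OF assms(2) f] Suc.prems] by simp
    finally show ?case .
  qed
  then show ?thesis
    by (simp add: composition_operator_funpow tensor_one_def case_prod_beta)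
qed

end
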